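(* Let $2\le m\le 3$ and let $n\ge 3$ be an odd integer. Then $\chi_{lat}(A(mK_n,K_2))=n$ and $\chi_{la}(A(mK_n,K_2)\vee K_1)=n+1$.
   Context: All graphs are finite and simple. Let $G$ be a graph with $p$ vertices and $q$ edges. A local antimagic labeling of $G$ is a bijection $g:E(G)\to\{1,2,\ldots,q\}$ such that $g^+(u)\neq g^+(v)$ for every edge $uv\in E(G)$, where $g^+(u)$ is the sum of $g(e)$ over all edges $e$ incident to $u$. The local antimagic chromatic number $\chi_{la}(G)$ is the minimum, over all local antimagic labelings $g$ of $G$, of the number of distinct values of $g^+$ on $V(G)$. (It is known that every connected graph of order at least 3 has a local antimagic labeling.) A local antimagic total labeling of $G$ is a bijection $f:V(G)\cup E(G)\to\{1,2,\ldots,p+q\}$ such that $w_f(u)\neq w_f(v)$ for every edge $uv\in E(G)$, where $w_f(u)=f(u)+\sum_{uv\in E(G)}f(uv)$ (the sum is over all edges incident to $u$). The local antimagic total chromatic number $\chi_{lat}(G)$ is the minimum, over all local antimagic total labelings $f$ of $G$, of the number of distinct values of $w_f$ on $V(G)$. (It is known that every graph has a local antimagic total labeling.) $G\vee K_1$ is the graph obtained from $G$ by joining a new vertex to every vertex of $G$. $A(mK_n,K_2)$ denotes the amalgamation of $m$ copies of the complete graph $K_n$ over $K_2$: the simple graph obtained from $m$ copies of $K_n$ by choosing an edge ($K_2$) in each copy and identifying these $m$ copies of $K_2$ into a single $K_2$. Equivalently, it is the join $(mK_{n-2})\vee K_2$, where $mK_{n-2}$ is the disjoint union of $m$ copies of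 $K_{n-2}$. *)

theory Defs
  imports Main
begin

section \<open>Finite simple graphs\<close>

record 'v ugraph =
  verts :: "'v set"
  edges :: "'v set set"

definition simple_graph :: "'v ugraph \<Rightarrow> bool" where
  "simple_graph G \<longleftrightarrow>
     finite (verts G) \<and> (\<forall>e\<in>edges G. e \<subseteq> verts G \<and> card e = 2)"

definition graph_iso :: "'a ugraph \<Rightarrow> 'b ugraph \<Rightarrow> bool" where
  "graph_iso G H \<longleftrightarrow>
     (\<exists>h. bij_betw h (verts G) (verts H) \<and> edges H = (\<lambda>e. h ` e) ` edges G)"

section \<open>Local antimagic labelings\<close>

definition edge_weight :: "'v ugraph \<Rightarrow> ('v set \<Rightarrow> nat) \<Rightarrow> 'v \<Rightarrow> nat" where
  "edge_weight G g u = (\<Sum>e | e \<in> edges G \<and> u \<in> e. g e)"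

definition local_antimagic :: "'v ugraph \<Rightarrow> ('v set \<Rightarrow> nat) \<Rightarrow> bool" where
  "local_antimagic G g \<longleftrightarrow>
     bij_betw g (edges G) {1..card (edges G)} \<and>
     (\<forall>u v. {u, v} \<in> edges G \<longrightarrow> edge_weight G g u \<noteq> edge_weight G g v)"

definition chi_la :: "'v ugraph \<Rightarrow> nat" where
  "chi_la G =
     (LEAST k. \<exists>g. local_antimagic G g \<and> k = card (edge_weight G g ` verts G))"

text \<open>The domain \<open>V(G) \<union> E(G)\<close> of a total labeling is the disjoint sum of the two sets:
  \<open>f (Inl u)\<close> is the label of the vertex \<open>u\<close> and \<open>f (Inr e)\<close> that of the edge \<open>e\<close>.\<close>

definition total_weight :: "'v ugraph \<Rightarrow> ('v + 'v set \<Rightarrow> nat) \<Rightarrow> 'v \<Rightarrow> nat" where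
  "total_weight G f u = f (Inl u) + (\<Sum>e | e \<in> edges G \<and> u \<in> e. f (Inr e))"

definition local_antimagic_total :: "'v ugraph \<Rightarrow> ('v + 'v set \<Rightarrow> nat) \<Rightarrow> bool" where
  "local_antimagic_total G f \<longleftrightarrow>
     bij_betw f (verts G <+> edges G) {1..card (verts G) + card (edges G)} \<and>
     (\<forall>u v. {u, v} \<in> edges G \<longrightarrow> total_weight G f u \<noteq> total_weight G f v)"

definition chi_lat :: "'v ugraph \<Rightarrow> nat" where
  "chi_lat G =
     (LEAST k. \<exists>f. local_antimagic_total G f \<and> k = card (total_weight G f ` verts G))"

section \<open>Graph constructions\<close>

definition complete_graph :: "nat \<Rightarrow> nat ugraph" where
  "complete_graph n =
     \<lparr>verts = {..<n}, edges = {{u, v} | u v. u < n \<and> v < n \<and> u \<noteq> v}\<rparr>"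

definition copies :: "nat \<Rightarrow> 'v ugraph \<Rightarrow> (nat \<times> 'v) ugraph" where
  "copies m G =
     \<lparr>verts = {..<m} \<times> verts G, edges = {Pair i ` e | i e. i < m \<and> e \<in> edges G}\<rparr>"

definition join :: "'a ugraph \<Rightarrow> 'b ugraph \<Rightarrow> ('a + 'b) ugraph" where
  "join G H =
     \<lparr>verts = verts G <+> verts H,
      edges = (\<lambda>e. Inl ` e) ` edges G \<union> (\<lambda>e. Inr ` e) ` edges H \<union>
              {{Inl u, Inr v} | u v. u \<in> verts G \<and> v \<in> verts H}\<rparr>"

text \<open>The graph obtained by identifying vertices with the same image under \<open>r\<close>; as edges are
  sets, parallel edges are merged.\<close>

definition identify :: "('a \<Rightarrow> 'b) \<Rightarrow> 'a ugraph \<Rightarrow> 'b ugraph" where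
  "identify r G = \<lparr>verts = r ` verts G, edges = (\<lambda>e. r ` e) ` edges G\<rparr>"

text \<open>\<open>A(mK\<^sub>n, K\<^sub>2)\<close>: in every copy \<open>i\<close> the chosen edge joins \<open>(i, 0)\<close> and \<open>(i, 1)\<close>, and all
  these edges are identified with the one in copy \<open>0\<close>. By the symmetry of the complete graph,
  other choices of the edges and of their orientations give isomorphic graphs.\<close>

definition glue_K2 :: "nat \<times> nat \<Rightarrow> nat \<times> nat" where
  "glue_K2 = (\<lambda>(i, v). if v < 2 then (0, v) else (i, v))"

definition amalg_K2 :: "nat \<Rightarrow> nat \<Rightarrow> (nat \<times> nat) ugraph" where
  "amalg_K2 m n = identify glue_K2 (copies m (complete_graph n))"

section \<open>Sanity checks\<close>

lemma simple_graph_complete_graph: "simple_graph (complete_graph n)"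
  by (auto simp: simple_graph_def complete_graph_def card_2_iff)

lemma simple_graph_copies:
  assumes "simple_graph G" shows "simple_graph (copies m G)"
  using assms by (auto simp: simple_graph_def copies_def card_image inj_on_def)

lemma simple_graph_join:
  assumes "simple_graph G" "simple_graph H" shows "simple_graph (join G H)"
  using assms by (auto simp: simple_graph_def join_def card_image)

lemma simple_graph_amalg_K2: "simple_graph (amalg_K2 m n)"
proof -
  have inj: "inj_on glue_K2 (Pair i ` e)" for i e
    by (auto simp: inj_on_def glue_K2_def split: if_splits)
  have S: "simple_graph (copies m (complete_graph n))"
    by (intro simple_graph_copies simple_graph_complete_graph)
  have "card (glue_K2 ` e) = 2" if e: "e \<in> edges (copies m (complete_graph n))" for e
  proof -
    obtain i d where "e = Pair i ` d" using e by (auto simp: copies_def)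
    then have "card (glue_K2 ` e) = card e" using inj card_image by blast
    then show ?thesis using S e by (auto simp: simple_graph_def)
  qed
  then show ?thesis using S
    by (auto simp: simple_graph_def amalg_K2_def identify_def)
qed

lemma amalg_K2_iso_join:
  assumes "m \<ge> 1" "n \<ge> 2"
  shows "graph_iso (join (copies m (complete_graph (n - 2))) (complete_graph 2)) (amalg_K2 m n)"
proof -
  define h :: "(nat \<times> nat) + nat \<Rightarrow> nat \<times> nat"
    where "h = case_sum (\<lambda>(i, v). (i, v + 2)) (\<lambda>v. (0, v))"
  let ?J = "join (copies m (complete_graph (n - 2))) (complete_graph 2)"
  have hl: "h (Inl (i, v)) = (i, v + 2)" and hr: "h (Inr w) = (0, w)" for i v w
    by (simp_all add: h_def)
  have VJ: "verts ?J = ({..<m} \<times> {..<n - 2}) <+> {..<2}"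
    by (simp add: join_def copies_def complete_graph_def)
  have gE: "{glue_K2 (i, u), glue_K2 (i, v)} \<in> edges (amalg_K2 m n)"
    if "i < m" "u < n" "v < n" "u \<noteq> v" for i u v
  proof -
    have "{u, v} \<in> edges (complete_graph n)" using that by (auto simp: complete_graph_def)
    then have "Pair i ` {u, v} \<in> edges (copies m (complete_graph n))"
      using that unfolding copies_def by (simp del: image_insert) blast
    then have "glue_K2 ` Pair i ` {u, v} \<in> edges (amalg_K2 m n)"
      unfolding amalg_K2_def identify_def by (simp del: image_insert)
    then show ?thesis by simp
  qed
  have Ecases: "\<exists>i u v. i < m \<and> u < v \<and> v < n \<and> e = {glue_K2 (i, u), glue_K2 (i, v)}"
    if "e \<in> edges (amalg_K2 m n)" for e
  proof -
    obtain i u v where *: "i < m" "u < n" "v < n" "u \<noteq> v" "e = {glue_K2 (i, u), glue_K2 (i, v)}"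
    proof -
      obtain i d where "i < m" "d \<in> edges (complete_graph n)" "e = glue_K2 ` Pair i ` d"
        using \<open>e \<in> edges (amalg_K2 m n)\<close> by (auto simp: amalg_K2_def identify_def copies_def)
      then show thesis using that by (auto simp: complete_graph_def)
    qed
    show ?thesis
    proof (cases "u < v")
      case True then show ?thesis using * by blast
    next
      case False then have "v < u" using * by simp
      then show ?thesis using * by (metis insert_commute)
    qed
  qed
  have JL: "{Inl (i, u), Inl (i, v)} \<in> edges ?J"
    if "i < m" "u < n - 2" "v < n - 2" "u \<noteq> v" for i u v
  proof -
    have "{u, v} \<in> edges (complete_graph (n - 2))" using that by (auto simp: complete_graph_def)
    then have "Pair i ` {u, v} \<in> edges (copies m (complete_graph (n - 2)))"
      using that unfolding copies_def by (simp del: image_insert) blast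
    then have "Inl ` Pair i ` {u, v} \<in> edges ?J" unfolding join_def by (simp del: image_insert)
    then show ?thesis by simp
  qed
  have JM: "{Inl (i, u), Inr w} \<in> edges ?J" if "i < m" "u < n - 2" "w < 2" for i u w
    using that by (auto simp: join_def copies_def complete_graph_def)
  have JR: "{Inr 0, Inr 1} \<in> edges ?J"
  proof -
    have "{0, 1} \<in> edges (complete_graph 2)"
      unfolding complete_graph_def by simp (metis less_2_cases_iff zero_neq_one One_nat_def)
    then have "Inr ` {0, 1} \<in> edges ?J" unfolding join_def by (simp del: image_insert)
    then show ?thesis by simp
  qed
  have "bij_betw h (verts ?J) (verts (amalg_K2 m n))"
    unfolding bij_betw_def
  proof
    show "inj_on h (verts ?J)" unfolding VJ by (auto simp: inj_on_def hl hr)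
    show "h ` verts ?J = verts (amalg_K2 m n)"
    proof
      show "h ` verts ?J \<subseteq> verts (amalg_K2 m n)"
      proof
        fix x assume "x \<in> h ` verts ?J"
        then consider i v where "x = (i, v + 2)" "i < m" "v < n - 2" | w where "x = (0, w)" "w < 2"
          unfolding VJ by (auto simp: hl hr)
        then have "\<exists>i v. i < m \<and> v < n \<and> x = glue_K2 (i, v)"
        proof cases
          case 1 then show ?thesis by (intro exI[of _ i] exI[of _ "v + 2"]) (auto simp: glue_K2_def)
        next
          case 2 then show ?thesis using assms by (intro exI[of _ 0] exI[of _ w]) (auto simp: glue_K2_def)
        qed
        then show "x \<in> verts (amalg_K2 m n)"
          by (auto simp: amalg_K2_def identify_def copies_def complete_graph_def)
      qed
      show "verts (amalg_K2 m n) \<subseteq> h ` verts ?J"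
      proof
        fix x assume "x \<in> verts (amalg_K2 m n)"
        then obtain i v where iv: "i < m" "v < n" "x = glue_K2 (i, v)"
          by (auto simp: amalg_K2_def identify_def copies_def complete_graph_def)
        show "x \<in> h ` verts ?J"
        proof (cases "v < 2")
          case True
          then show ?thesis using iv unfolding VJ by (intro image_eqI[of _ _ "Inr v"]) (auto simp: hr glue_K2_def)
        next
          case False
          then show ?thesis using iv unfolding VJ
            by (intro image_eqI[of _ _ "Inl (i, v - 2)"]) (auto simp: hl glue_K2_def)
        qed
      qed
    qed
  qed
  moreover have "edges (amalg_K2 m n) = (\<lambda>e. h ` e) ` edges ?J"
  proof
    show "edges (amalg_K2 m n) \<subseteq> (\<lambda>e. h ` e) ` edges ?J"
    proof
      fix e assume "e \<in> edges (amalg_K2 m n)"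
      then obtain i u v where *: "i < m" "u < v" "v < n" "e = {glue_K2 (i, u), glue_K2 (i, v)}"
        using Ecases by blast
      consider "v < 2" | "u < 2" "v \<ge> 2" | "u \<ge> 2" using \<open>u < v\<close> by linarith
      then show "e \<in> (\<lambda>e. h ` e) ` edges ?J"
      proof cases
        case 1
        then have "u = 0" "v = 1" using * by auto
        then show ?thesis using * JR by (intro image_eqI[OF _ JR]) (auto simp: hr glue_K2_def)
      next
        case 2
        then have "{Inl (i, v - 2), Inr u} \<in> edges ?J" using * by (intro JM) auto
        then show ?thesis using * 2 by (intro image_eqI) (auto simp: hl hr glue_K2_def)
      next
        case 3
        then have "{Inl (i, u - 2), Inl (i, v - 2)} \<in> edges ?J" using * by (intro JL) auto
        then show ?thesis using * 3 by (intro image_eqI) (auto simp: hl hr glue_K2_def)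
      qed
    qed
    show "(\<lambda>e. h ` e) ` edges ?J \<subseteq> edges (amalg_K2 m n)"
    proof
      fix d assume "d \<in> (\<lambda>e. h ` e) ` edges ?J"
      then consider i u v where "i < m" "u < n - 2" "v < n - 2" "u \<noteq> v" "d = {(i, u + 2), (i, v + 2)}"
        | u v where "u < 2" "v < 2" "u \<noteq> v" "d = {(0, u), (0, v)}"
        | i u w where "i < m" "u < n - 2" "w < 2" "d = {(i, u + 2), (0, w)}"
        by (auto simp: join_def copies_def complete_graph_def hl hr)
      then show "d \<in> edges (amalg_K2 m n)"
      proof cases
        case 1 then show ?thesis using gE[of i "u + 2" "v + 2"] by (simp add: glue_K2_def)
      next
        case 2 then show ?thesis using gE[of 0 u v] assms by (simp add: glue_K2_def)
      next
        case 3 then show ?thesis using gE[of i "u + 2" w] by (simp add: glue_K2_def)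
      qed
    qed
  qed
  ultimately show ?thesis unfolding graph_iso_def by blast
qed

end

theory Submission
  imports Defs
begin

text \<open>
  Both graphs contain cliques of the claimed sizes, \<open>K\<^sub>n\<close> and \<open>K\<^sub>n \<or> K\<^sub>1\<close>, and adjacent vertices have
  different weights, so \<open>n\<close> and \<open>n + 1\<close> are lower bounds (\<open>card_clique_le_card_weights\<close>). For the
  upper bounds one labeling serves both: a total labeling of \<open>G\<close> is an edge labeling of the cone
  \<open>G \<or> K\<^sub>1\<close>, the label of a vertex being that of the edge to the apex, and the weights on \<open>G\<close> agree
  (\<open>total_weight_cone\<close>). As the apex is adjacent to all other vertices, a labeling of the cone with
  \<open>n + 1\<close> weights leaves only \<open>n\<close> for \<open>G\<close>.

  With \<open>t = n - 2\<close>, which is odd, the cone is \<open>m\<close> copies of \<open>K\<^bsub>t+3\<^esub>\<close> sharing a triangle. The vertices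
  of the triangle are called hubs here, the other ones are the \<open>t\<close> private vertices of each copy.
  An edge that is not in the triangle has a position \<open>(j, k)\<close> in \<open>K\<^bsub>t+3\<^esub>\<close>, with \<open>k < j\<close> and \<open>k < t\<close>, and
  a copy \<open>i < m\<close>. Enumerate the positions row by row and give the \<open>m\<close> edges at each position
  \<open>m\<close> consecutive labels; the triangle gets the largest labels. (For \<open>m = 2\<close> the last row has to
  deviate, see \<open>offset\<close>.) The order of the labels inside each position is still free, and is used to make
  the weight of the private vertex \<open>j\<close> the same in all copies:

  \<^item> Inside the copies, the labels at \<open>(j, k)\<close> increase with \<open>i\<close> if \<open>j + k\<close> is even and decrease if it
    is odd. Since \<open>t\<close> is odd, the signs \<open>(-1)\<^sup>j\<^sup>+\<^sup>k\<close> for \<open>k \<noteq> j\<close> add up to \<open>(-1)\<^sup>j - 1\<close>, so the part of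
    the weight from inside the copy is independent of \<open>i\<close> for even \<open>j\<close> and contains \<open>-2 * i\<close> for
    odd \<open>j\<close> (\<open>alternating_sum\<close>, \<open>edge_label_inner\<close>).
  \<^item> The three edges to the hubs cancel this dependence (\<open>hub_labels_balance\<close>).

  All weights are then ordered by the order of the positions: the weight of a private vertex grows
  with \<open>j\<close>, the hubs outweigh the private vertices, and the hubs are ordered by their rows
  (\<open>row_sum_less\<close>, \<open>row_sum_less_hub_sum\<close>, \<open>hub_sum_less\<close>). So there are
  \<open>t + 3 = n + 1\<close> weights, one for each vertex of \<open>K\<^bsub>t+3\<^esub>\<close>, and adjacent vertices differ.
\<close>

section \<open>Cliques bound the number of weights from below\<close>

lemma card_clique_le_card_weights:
  assumes "finite V" "K \<subseteq> V"
    and "\<And>u v. u \<in> K \<Longrightarrow> v \<in> K \<Longrightarrow> u \<noteq> v \<Longrightarrow> w u \<noteq> w v"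
  shows "card K \<le> card (w ` V)"
proof -
  have "card K = card (w ` K)"
    using assms(3) by (intro card_image[symmetric]) (auto simp: inj_on_def)
  also have "\<dots> \<le> card (w ` V)"
    using assms(1,2) by (intro card_mono) auto
  finally show ?thesis .
qed

lemma chi_la_eqI:
  assumes "local_antimagic G g" "card (edge_weight G g ` verts G) \<le> card K"
    and "finite (verts G)" "K \<subseteq> verts G"
    and "\<And>u v. u \<in> K \<Longrightarrow> v \<in> K \<Longrightarrow> u \<noteq> v \<Longrightarrow> {u, v} \<in> edges G"
  shows "chi_la G = card K"
proof -
  have ge: "card K \<le> card (edge_weight G h ` verts G)" if "local_antimagic G h" for h
    using that assms(3-5) by (intro card_clique_le_card_weights) (auto simp: local_antimagic_def)
  show ?thesis
    unfolding chi_la_def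
  proof (rule Least_equality)
    show "\<exists>h. local_antimagic G h \<and> card K = card (edge_weight G h ` verts G)"
      using ge[OF assms(1)] assms(1,2) by (metis le_antisym)
  qed (use ge in blast)
qed

lemma chi_lat_eqI:
  assumes "local_antimagic_total G f" "card (total_weight G f ` verts G) \<le> card K"
    and "finite (verts G)" "K \<subseteq> verts G"
    and "\<And>u v. u \<in> K \<Longrightarrow> v \<in> K \<Longrightarrow> u \<noteq> v \<Longrightarrow> {u, v} \<in> edges G"
  shows "chi_lat G = card K"
proof -
  have ge: "card K \<le> card (total_weight G h ` verts G)" if "local_antimagic_total G h" for h
    using that assms(3-5) by (intro card_clique_le_card_weights) (auto simp: local_antimagic_total_def)
  show ?thesis
    unfolding chi_lat_def
  proof (rule Least_equality)
    show "\<exists>h. local_antimagic_total G h \<and> card K = card (total_weight G h ` verts G)"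
      using ge[OF assms(1)] assms(1,2) by (metis le_antisym)
  qed (use ge in blast)
qed

section \<open>Total labelings as edge labelings of the cone\<close>

definition cone :: "'v ugraph \<Rightarrow> ('v + nat) ugraph" where
  "cone G = join G (complete_graph 1)"

definition cone_edge :: "'v + 'v set \<Rightarrow> ('v + nat) set" where
  "cone_edge = case_sum (\<lambda>u. {Inl u, Inr 0}) (\<lambda>e. Inl ` e)"

lemma verts_cone: "verts (cone G) = insert (Inr 0) (Inl ` verts G)"
  by (auto simp: cone_def join_def complete_graph_def)

lemma edges_cone: "edges (cone G) = (\<lambda>u. {Inl u, Inr 0}) ` verts G \<union> (`) Inl ` edges G"
  by (auto simp: cone_def join_def complete_graph_def)

text \<open>A total labeling of \<open>G\<close> and an edge labeling of the cone use the same number of labels: the vertices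
  of \<open>G\<close> correspond to the edges at the apex.\<close>

lemma bij_betw_cone_edge: "bij_betw cone_edge (verts G <+> edges G) (edges (cone G))"
proof -
  have "cone_edge x \<noteq> cone_edge y" if "x \<noteq> y" for x y :: "'v + 'v set"
    using that by (cases x; cases y)
      (auto simp: cone_edge_def doubleton_eq_iff inj_image_eq_iff simp del: image_insert)
  then have "inj_on cone_edge (verts G <+> edges G)"
    unfolding inj_on_def by blast
  moreover have "cone_edge ` (verts G <+> edges G) = edges (cone G)"
    by (simp only: Plus_def image_Un image_image edges_cone cone_edge_def sum.case)
  ultimately show ?thesis
    by (simp add: bij_betw_def)
qed

lemma total_weight_cone:
  fixes G :: "'v ugraph"
  assumes "finite (edges G)" "u \<in> verts G"
  shows "total_weight G (g \<circ> cone_edge) u = edge_weight (cone G) g (Inl u)"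
proof -
  have *: "{e \<in> edges (cone G). Inl u \<in> e} = insert {Inl u, Inr 0} ((`) Inl ` {e \<in> edges G. u \<in> e})"
    using assms(2) by (auto simp: edges_cone)
  have "inj_on ((`) Inl :: 'v set \<Rightarrow> ('v + nat) set) {e \<in> edges G. u \<in> e}"
    by (simp add: inj_on_def inj_image_eq_iff)
  moreover have "{Inl u, Inr (0 :: nat)} \<notin> (`) Inl ` {e \<in> edges G. u \<in> e}"
    by blast
  ultimately have "edge_weight (cone G) g (Inl u) =
      g {Inl u, Inr 0} + (\<Sum>e | e \<in> edges G \<and> u \<in> e. g (Inl ` e))"
    unfolding edge_weight_def * using assms(1) by (simp add: sum.reindex)
  then show ?thesis
    by (simp add: total_weight_def cone_edge_def)
qed

lemma finite_edges: "simple_graph G \<Longrightarrow> finite (edges G)"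
  by (auto simp: simple_graph_def intro: finite_subset[of _ "Pow (verts G)"])

lemma local_antimagic_total_cone:
  assumes "simple_graph G" "local_antimagic (cone G) g"
  shows "local_antimagic_total G (g \<circ> cone_edge)"
proof -
  have fin: "finite (verts G)" "finite (edges G)"
    using assms(1) finite_edges by (auto simp: simple_graph_def)
  have "card (verts G) + card (edges G) = card (edges (cone G))"
    using bij_betw_same_card[OF bij_betw_cone_edge, of G] fin by (simp add: card_Plus)
  moreover have "total_weight G (g \<circ> cone_edge) u \<noteq> total_weight G (g \<circ> cone_edge) v"
    if "{u, v} \<in> edges G" for u v
  proof -
    have "{Inl u, Inl v} \<in> edges (cone G)"
      using that unfolding edges_cone by (auto intro!: image_eqI[of _ _ "{u, v}"])
    moreover have "u \<in> verts G" "v \<in> verts G"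
      using that assms(1) by (auto simp: simple_graph_def)
    ultimately show ?thesis
      using assms(2) fin by (simp add: total_weight_cone local_antimagic_def)
  qed
  ultimately show ?thesis
    using assms(2) bij_betw_trans[OF bij_betw_cone_edge]
    by (auto simp: local_antimagic_total_def local_antimagic_def)
qed

lemma edge_weight_neighbours:
  assumes "simple_graph G"
  shows "edge_weight G g u = (\<Sum>v | {u, v} \<in> edges G. g {u, v})"
proof -
  have "\<exists>v. e = {u, v}" if "e \<in> edges G" "u \<in> e" for e
  proof -
    have "card e = 2"
      using assms that(1) by (simp add: simple_graph_def)
    then obtain x y where "e = {x, y}"
      unfolding card_2_iff by blast
    then show ?thesis
      using that(2) by blast
  qed
  then have "{e. e \<in> edges G \<and> u \<in> e} = (\<lambda>v. {u, v}) ` {v. {u, v} \<in> edges G}"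
    by blast
  moreover have "inj_on (\<lambda>v. {u, v}) {v. {u, v} \<in> edges G}"
    by (auto simp: inj_on_def doubleton_eq_iff)
  ultimately show ?thesis
    by (simp add: edge_weight_def sum.reindex)
qed

section \<open>Labels for the edges of the amalgam of complete graphs over a triangle\<close>

text \<open>Row \<open>j\<close> of the positions has \<open>min j t\<close> entries \<open>k\<close>: the rows \<open>j < t\<close> form a triangle, the rows
  \<open>t\<close>, \<open>t + 1\<close>, \<open>t + 2\<close> of the hubs have full length \<open>t\<close>. The position \<open>(j, k)\<close> has number
  \<open>staircase t j + k\<close>.\<close>

definition staircase :: "nat \<Rightarrow> nat \<Rightarrow> nat" where
  "staircase t j = (\<Sum>j'<j. min j' t)"

lemma staircase_mono: "j \<le> j' \<Longrightarrow> staircase t j \<le> staircase t j'"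
  unfolding staircase_def by (intro sum_mono2) auto

text \<open>Copy \<open>i\<close> has label \<open>m * (staircase t j + k) + offset m t i j k\<close> at the position \<open>(j, k)\<close>. In the
  rows of the hubs the offsets are listed by copy. They have to add up, over the three hubs, to a
  constant for even \<open>k\<close> and to a constant plus \<open>2 * i\<close> for odd \<open>k\<close>.

  For \<open>m = 3\<close> all offsets at a position form a permutation of \<open>1, 2, 3\<close>. For \<open>m = 2\<close> this is impossible:
  a private vertex has the odd degree \<open>t + 2\<close>, and an odd number of differences \<open>1\<close> or \<open>-1\<close> between
  the two copies cannot cancel. So the last row uses differences \<open>2\<close> instead. Its labels, counted
  from the start of the row, are paired as \<open>(1, 3), (2, 4), (5, 7), (6, 8), \<dots>\<close>, and the last pair
  skips the number \<open>2 * t\<close> and takes \<open>2 * t + 1\<close> because \<open>t\<close> is odd.\<close>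

definition offset :: "nat \<Rightarrow> nat \<Rightarrow> nat \<Rightarrow> nat \<Rightarrow> nat \<Rightarrow> nat" where
  "offset m t i j k =
    (if j < t then (if even (j + k) then i + 1 else m - i)
     else if j = t + 1 then i + 1
     else (if m = 2
           then (if j = t then (if even k then [1, 2] else [2, 1])
                 else (if even k then [3, 1] else [0, 2]))
           else (if j = t then (if even k then [2, 3, 1] else [1, 3, 2])
                 else (if even k then [3, 1, 2] else [2, 1, 3]))) ! i)"

text \<open>The three edges of the triangle get the largest labels, except that for \<open>m = 2\<close> the first of them
  takes the label \<open>2 * staircase t (t + 3)\<close> that is skipped in the last row.\<close>

definition code_label :: "nat \<Rightarrow> nat \<Rightarrow> nat \<Rightarrow> nat \<Rightarrow> nat \<Rightarrow> nat" where
  "code_label m t i j k =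
    (if k < t then m * (staircase t j + k) + offset m t i j k
     else m * staircase t (t + 3) + (if m = 2 \<and> j = t + 1 then 0 else (j - t) + (k - t)))"

text \<open>The symmetric form: the label of the edge between the vertices \<open>j\<close> and \<open>k\<close> of copy \<open>i\<close>.\<close>

definition edge_label :: "nat \<Rightarrow> nat \<Rightarrow> nat \<Rightarrow> nat \<Rightarrow> nat \<Rightarrow> nat" where
  "edge_label m t i j k = code_label m t i (max j k) (min j k)"

text \<open>Each edge is encoded once; the edges of the triangle, which belong to all copies, are counted in copy
  \<open>0\<close>.\<close>

definition codes :: "nat \<Rightarrow> nat \<Rightarrow> (nat \<times> nat \<times> nat) set" where
  "codes m t = {(i, j, k). i < m \<and> k < j \<and> j < t + 3 \<and> (t \<le> k \<longrightarrow> i = 0)}"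

lemma codes_eq:
  assumes "m \<ge> 1"
  shows "codes m t = {..<m} \<times> (SIGMA j:{..<t + 3}. {..<min j t}) \<union>
    {(0, t + 1, t), (0, t + 2, t), (0, t + 2, t + 1)}"
  using assms by (auto simp: codes_def)

lemma card_codes:
  assumes "m \<ge> 1"
  shows "card (codes m t) = m * staircase t (t + 3) + 3"
proof -
  have "card (codes m t) = card ({..<m} \<times> (SIGMA j:{..<t + 3}. {..<min j t})) + 
    card {(0::nat, t + 1, t), (0, t + 2, t), (0, t + 2, t + 1)}"
    unfolding codes_eq[OF assms] by (rule card_Un_disjoint) auto
  also have "card {(0::nat, t + 1, t), (0, t + 2, t), (0, t + 2, t + 1)} = 3"
    by simp
  finally show ?thesis
    by (simp add: card_cartesian_product staircase_def)
qed

locale odd_amalgam =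
  fixes m t :: nat
  assumes m: "m = 2 \<or> m = 3" and t: "odd t"
begin

lemma copy_cases:
  assumes "i < m" obtains "i = 0" | "i = 1" | "i = 2" "m = 3"
  using assms m by linarith

lemma offset_bounds:
  assumes "i < m" "\<not> (m = 2 \<and> t + 2 \<le> j)"
  shows "1 \<le> offset m t i j k \<and> offset m t i j k \<le> m"
  using assms m by (elim copy_cases) (auto simp: offset_def)

lemma offset_exceptional:
  assumes "i < 2" "j = t + 2"
  shows "offset 2 t i j k = (if even k then 3 - 2 * i else 2 * i)"
  using assms by (auto simp: offset_def less_2_cases_iff)

lemma offset_inject:
  assumes "i < m" "i' < m" "offset m t i j k = offset m t i' j k"
  shows "i = i'"
  using assms m by (elim copy_cases) (auto simp: offset_def split: if_splits)

text \<open>Off the exceptional row, \<open>k\<close> is a quotient by \<open>m\<close> and the offset determines the copy. On the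
  exceptional row the four residue classes modulo \<open>4\<close> tell apart the parity of \<open>k\<close> and the copy.\<close>

lemma block_inject:
  assumes "i < m" "i' < m" "j < t + 3"
    and eq: "m * k + offset m t i j k = m * k' + offset m t i' j k'"
  shows "i = i' \<and> k = k'"
proof (cases "m = 2 \<and> j = t + 2")
  case True
  then have "i < 2" "i' < 2"
    using assms by auto
  then have i: "i = 0 \<or> i = 1" "i' = 0 \<or> i' = 1"
    by auto
  have "2 * k + (if even k then 3 - 2 * i else 2 * i) = 2 * k' + (if even k' then 3 - 2 * i' else 2 * i')"
    using eq True \<open>i < 2\<close> \<open>i' < 2\<close> by (simp add: offset_exceptional)
  then show ?thesis
    using i by (elim disjE) (simp split: if_splits; presburger)+
next
  case False
  have "(m * k + offset m t i j k - 1) div m = k" "(m * k' + offset m t i' j k' - 1) div m = k'"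
    using offset_bounds[OF assms(1), of j k] offset_bounds[OF assms(2), of j k'] assms False
    by (auto intro!: div_nat_eqI simp: algebra_simps)
  then have "k = k'"
    using eq by simp
  then show ?thesis
    using eq offset_inject assms(1,2) by auto
qed

text \<open>The labels of different rows lie in disjoint intervals, so a label determines its row; only the last
  row for \<open>m = 2\<close> exceeds its interval.\<close>

lemma block_bounds:
  assumes "i < m" "j < t + 3" "k < min j t"
  shows "m * staircase t j < code_label m t i j k"
    and "j < t + 2 \<or> m = 3 \<Longrightarrow> code_label m t i j k \<le> m * staircase t (Suc j)"
proof -
  have "1 \<le> m * k + offset m t i j k"
  proof (cases "m = 2 \<and> j = t + 2")
    case True
    then show ?thesis
      using assms by (cases "k = 0") (auto simp: offset_exceptional)
  next
    case False
    then show ?thesis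
      using offset_bounds[OF assms(1), of j k] assms by auto
  qed
  then show "m * staircase t j < code_label m t i j k"
    using assms unfolding code_label_def add_mult_distrib2 by (simp only: min_less_iff_conj if_True)
  show "code_label m t i j k \<le> m * staircase t (Suc j)" if "j < t + 2 \<or> m = 3"
  proof -
    have "code_label m t i j k \<le> m * (staircase t j + k) + m"
      using offset_bounds[OF assms(1), of j k] that assms by (auto simp: code_label_def)
    also have "\<dots> = m * (staircase t j + Suc k)"
      by simp
    also have "\<dots> \<le> m * staircase t (Suc j)"
      using assms by (intro mult_le_mono2) (simp add: staircase_def)
    finally show ?thesis .
  qed
qed

text \<open>Counted from the start of the row, the label that is left free is \<open>2 * t\<close>. Even labels occur only for
  odd \<open>k\<close>, as \<open>2 * k\<close> and \<open>2 * k + 2\<close>; as \<open>k < t\<close>, this leaves \<open>k = t - 1\<close>, which is even.\<close>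

lemma code_label_exceptional:
  assumes "i < m" "m = 2" "k < t"
  shows "code_label m t i (t + 2) k \<le> m * staircase t (t + 3) + 1"
    and "code_label m t i (t + 2) k \<noteq> m * staircase t (t + 3)"
proof -
  have st: "m * staircase t (t + 3) = m * staircase t (t + 2) + 2 * t"
    using assms by (simp add: staircase_def eval_nat_numeral)
  have l: "code_label m t i (t + 2) k = m * staircase t (t + 2) + (2 * k + (if even k then 3 - 2 * i else 2 * i))"
    using assms by (simp add: code_label_def offset_exceptional)
  have "i = 0 \<or> i = 1"
    using assms by auto
  then have "2 * k + (if even k then 3 - 2 * i else 2 * i) \<le> 2 * t + 1 \<and>
    2 * k + (if even k then 3 - 2 * i else 2 * i) \<noteq> 2 * t"
    using assms t by (elim disjE) (simp; presburger)+
  then show "code_label m t i (t + 2) k \<le> m * staircase t (t + 3) + 1"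
    and "code_label m t i (t + 2) k \<noteq> m * staircase t (t + 3)"
    unfolding st l by auto
qed

lemma code_label_less_later_row:
  assumes "i < m" "i' < m" "j < j'" "j' < t + 3" "k < min j t" "k' < min j' t"
  shows "code_label m t i j k < code_label m t i' j' k'"
proof -
  have "code_label m t i j k \<le> m * staircase t (Suc j)"
    using assms by (intro block_bounds) auto
  also have "\<dots> \<le> m * staircase t j'"
    using assms by (intro mult_le_mono2 staircase_mono) auto
  also have "\<dots> < code_label m t i' j' k'"
    using assms by (intro block_bounds) auto
  finally show ?thesis .
qed

lemma code_label_le_top:
  assumes "i < m" "j < t + 3" "k < min j t"
  shows "code_label m t i j k \<le> m * staircase t (t + 3) + 1"
    and "m = 3 \<or> j < t + 2 \<Longrightarrow> code_label m t i j k \<le> m * staircase t (t + 3)"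
    and "m = 2 \<Longrightarrow> code_label m t i j k \<noteq> m * staircase t (t + 3)"
proof -
  show 1: "code_label m t i j k \<le> m * staircase t (t + 3)" if "m = 3 \<or> j < t + 2"
  proof -
    have "code_label m t i j k \<le> m * staircase t (Suc j)"
      using assms that by (intro block_bounds) auto
    also have "\<dots> \<le> m * staircase t (t + 3)"
      using assms by (intro mult_le_mono2 staircase_mono) auto
    finally show ?thesis .
  qed
  have 2: "m = 2 \<and> j = t + 2" if "\<not> (m = 3 \<or> j < t + 2)"
    using that assms m by auto
  show "code_label m t i j k \<le> m * staircase t (t + 3) + 1"
    using 1 2 code_label_exceptional(1)[OF assms(1), of k] assms(3) by fastforce
  show "code_label m t i j k \<noteq> m * staircase t (t + 3)" if "m = 2"
  proof (cases "j = t + 2")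
    case True
    then show ?thesis using code_label_exceptional(2) assms that by auto
  next
    case False
    then have "code_label m t i j k \<le> m * staircase t (Suc j)" "Suc j \<le> t + 2"
      using assms by (auto intro!: block_bounds)
    then have "code_label m t i j k \<le> m * staircase t (t + 2)"
      by (meson le_trans mult_le_mono2 staircase_mono)
    also have "\<dots> < m * staircase t (t + 3)"
      using t that by (simp add: staircase_def eval_nat_numeral odd_pos)
    finally show ?thesis by simp
  qed
qed

text \<open>Injectivity is enough: all labels are in the range, and there are as many codes as labels.\<close>

lemma bij_betw_code_label:
  "bij_betw (\<lambda>(i, j, k). code_label m t i j k) (codes m t) {1..m * staircase t (t + 3) + 3}"
    (is "bij_betw ?f _ {1..?N + 3}")
proof -
  let ?A = "{..<m} \<times> (SIGMA j:{..<t + 3}. {..<min j t})"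
  let ?T = "{(0, t + 1, t), (0, t + 2, t), (0, t + 2, t + 1)}"
  have codes: "codes m t = ?A \<union> ?T"
    using m by (intro codes_eq) auto
  have A: "inj_on ?f ?A"
  proof (intro inj_onI, clarsimp)
    fix i j k i' j' k'
    assume *: "i < m" "j < t + 3" "k < j" "k < t" "i' < m" "j' < t + 3" "k' < j'" "k' < t"
      and eq: "code_label m t i j k = code_label m t i' j' k'"
    have "j = j'"
      using code_label_less_later_row[of i i' j j' k k'] code_label_less_later_row[of i' i j' j k' k] * eq
      by (cases j j' rule: linorder_cases) auto
    then show "i = i' \<and> j = j' \<and> k = k'"
      using block_inject[of i i' j k k'] * eq by (auto simp: code_label_def algebra_simps)
  qed
  have T: "inj_on ?f ?T" "?f ` ?T \<subseteq> {1..?N + 3}"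
    "?f ` ?T = {if m = 2 then ?N else ?N + 1, ?N + 2, ?N + 3}"
  proof -
    have "staircase t (t + 3) > 0"
      using t by (simp add: staircase_def eval_nat_numeral odd_pos)
    then show "inj_on ?f ?T" "?f ` ?T \<subseteq> {1..?N + 3}"
      "?f ` ?T = {if m = 2 then ?N else ?N + 1, ?N + 2, ?N + 3}"
      using m by (auto simp: code_label_def)
  qed
  have "inj_on ?f (codes m t)"
    unfolding codes
  proof (subst inj_on_Un, intro conjI A T)
    have "?f x \<notin> ?f ` ?T" if "x \<in> ?A" for x
    proof -
      obtain i j k where x: "x = (i, j, k)" "i < m" "j < t + 3" "k < min j t"
        using \<open>x \<in> ?A\<close> by auto
      show ?thesis
        unfolding T(3) using code_label_le_top[OF x(2-4)] x(1) m by auto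
    qed
    then show "?f ` (?A - ?T) \<inter> ?f ` (?T - ?A) = {}"
      by blast
  qed
  moreover have "?f ` codes m t \<subseteq> {1..?N + 3}"
  proof -
    have "?f x \<in> {1..?N + 3}" if "x \<in> ?A" for x
    proof -
      obtain i j k where x: "x = (i, j, k)" "i < m" "j < t + 3" "k < min j t"
        using \<open>x \<in> ?A\<close> by auto
      show ?thesis
        using code_label_le_top(1)[OF x(2-4)] block_bounds(1)[OF x(2-4)] x(1) by auto
    qed
    then show ?thesis
      unfolding codes image_Un using T(2) by blast
  qed
  moreover have "card (codes m t) = card {1..?N + 3}"
    using m by (subst card_codes) auto
  ultimately show ?thesis
    by (metis bij_betw_def card_image card_subset_eq finite_atLeastAtMost)
qed

section \<open>Balanced rows and increasing weights\<close>

text \<open>These are the weights of a private vertex (\<open>j < t\<close>) and of a hub (\<open>j \<ge> t\<close>). A hub is adjacent to the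
  private vertices of every copy.\<close>

definition row_sum :: "nat \<Rightarrow> nat \<Rightarrow> nat" where
  "row_sum i j = (\<Sum>k\<in>{..<t + 3} - {j}. edge_label m t i j k)"

definition hub_sum :: "nat \<Rightarrow> nat" where
  "hub_sum j = (\<Sum>i<m. \<Sum>k<t. edge_label m t i j k) + (\<Sum>k\<in>{t..<t + 3} - {j}. edge_label m t 0 j k)"

lemma row_sum_split:
  assumes "j < t"
  shows "row_sum i j = (\<Sum>k\<in>{..<t} - {j}. edge_label m t i j k) +
    (code_label m t i t j + code_label m t i (t + 1) j + code_label m t i (t + 2) j)"
proof -
  have "{..<t + 3} - {j} = ({..<t} - {j}) \<union> {t, t + 1, t + 2}"
    using assms by auto
  moreover have "({..<t} - {j}) \<inter> {t, t + 1, t + 2} = {}"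
    by auto
  ultimately have "row_sum i j =
      (\<Sum>k\<in>{..<t} - {j}. edge_label m t i j k) + (\<Sum>k\<in>{t, t + 1, t + 2}. edge_label m t i j k)"
    unfolding row_sum_def by (simp add: sum.union_disjoint)
  then show ?thesis
    using assms by (simp add: edge_label_def max_def min_def)
qed

lemma alternating_sum:
  assumes "j < t"
  shows "(\<Sum>k\<in>{..<t} - {j}. (- 1 :: int) ^ (j + k)) = (- 1) ^ j - 1"
proof -
  have "(\<Sum>k<s. (- 1 :: int) ^ (j + k)) = (if odd s then (- 1) ^ j else 0)" for s
    by (induction s) (auto simp: power_add)
  then have "(\<Sum>k<t. (- 1 :: int) ^ (j + k)) = (- 1) ^ j"
    using t by simp
  moreover have "(\<Sum>k<t. (- 1 :: int) ^ (j + k)) =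
      (- 1) ^ (j + j) + (\<Sum>k\<in>{..<t} - {j}. (- 1 :: int) ^ (j + k))"
    using assms by (intro sum.remove) auto
  ultimately show ?thesis
    by (simp add: power_add[symmetric] mult_2[symmetric])
qed

lemma edge_label_inner:
  assumes "i < m" "j < t" "k < t" "j \<noteq> k"
  shows "int (edge_label m t i j k) = int (edge_label m t 0 j k) + int i * (- 1) ^ (j + k)"
proof -
  have "max j k + min j k = j + k"
    by simp
  then show ?thesis
    using assms by (auto simp: edge_label_def code_label_def offset_def of_nat_diff max_def min_def add.commute)
qed

lemma hub_labels_balance:
  assumes "i < m" "j < t"
  shows "int (code_label m t i t j + code_label m t i (t + 1) j + code_label m t i (t + 2) j) =
    int (code_label m t 0 t j + code_label m t 0 (t + 1) j + code_label m t 0 (t + 2) j) + int i * (1 - (- 1) ^ j)"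
proof -
  have "i = 0 \<or> i = 1 \<or> i = 2"
    using assms(1) m by auto
  then show ?thesis
    using assms m by (cases "even j") (elim disjE; simp add: code_label_def offset_def)+
qed

text \<open>The dependence on the copy from the inner edges, \<open>i * ((-1)\<^sup>j - 1)\<close>, and that from the edges to
  the hubs, \<open>i * (1 - (-1)\<^sup>j)\<close>, cancel.\<close>

lemma row_sum_balanced:
  assumes "i < m" "j < t"
  shows "row_sum i j = row_sum 0 j"
proof -
  have "int (\<Sum>k\<in>{..<t} - {j}. edge_label m t i j k) =
      (\<Sum>k\<in>{..<t} - {j}. int (edge_label m t 0 j k) + int i * (- 1) ^ (j + k))"
    unfolding of_nat_sum using assms by (intro sum.cong edge_label_inner) auto
  also have "\<dots> = int (\<Sum>k\<in>{..<t} - {j}. edge_label m t 0 j k) + int i * ((- 1) ^ j - 1)"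
    using alternating_sum[OF assms(2)] by (simp add: sum.distrib flip: sum_distrib_left)
  finally have "int (row_sum i j) = int (row_sum 0 j)"
    using hub_labels_balance[OF assms] row_sum_split[OF assms(2), of i] row_sum_split[OF assms(2), of 0]
    by (simp only: of_nat_add) (simp add: right_diff_distrib)
  then show ?thesis
    by simp
qed

text \<open>Since the rows are balanced, weights can be compared within a single copy. Copy \<open>1\<close> is the right one:
  in copy \<open>0\<close> the exceptional row for \<open>m = 2\<close> reads \<open>3, 2, 7, 6, \<dots>\<close>, but in copy \<open>1\<close> it reads
  \<open>1, 4, 5, 8, \<dots>\<close> and is increasing.\<close>

lemma code_label_less_same_row:
  assumes "k < k'" "k' < min j t" "j < t + 3"
  shows "code_label m t 1 j k < code_label m t 1 j k'"
proof (cases "m = 2 \<and> j = t + 2")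
  case True
  then show ?thesis
    using assms by (auto simp: code_label_def offset_exceptional)
next
  case False
  have "code_label m t 1 j k \<le> m * (staircase t j + Suc k)"
    using offset_bounds[of 1 j k] assms False m by (auto simp: code_label_def)
  also have "\<dots> \<le> m * (staircase t j + k')"
    using assms by (intro mult_le_mono2) auto
  also have "\<dots> < code_label m t 1 j k'"
    using offset_bounds[of 1 j k'] assms False m by (auto simp: code_label_def)
  finally show ?thesis .
qed

lemma edge_label_less_copy_1:
  assumes "j < j'" "j' < t" "k < t" "k \<noteq> j" "k \<noteq> j'"
  shows "edge_label m t 1 j k < edge_label m t 1 j' k"
proof -
  have m1: "1 < m" using m by auto
  consider "k < j" | "j < k" "k < j'" | "j' < k" using assms by linarith
  then show ?thesis
  proof cases
    case 1
    then show ?thesis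
      using assms m1 code_label_less_later_row[of 1 1 j j' k k] by (simp add: edge_label_def max_def min_def)
  next
    case 2
    then show ?thesis
      using assms m1 code_label_less_later_row[of 1 1 k j' j k] by (simp add: edge_label_def max_def min_def)
  next
    case 3
    then show ?thesis
      using assms code_label_less_same_row[of j j' k] by (simp add: edge_label_def max_def min_def)
  qed
qed

text \<open>The edge between \<open>j\<close> and \<open>j'\<close> contributes to both sums; every other entry of the sum for \<open>j'\<close> comes
  later in the enumeration than the corresponding one for \<open>j\<close>.\<close>

lemma row_sum_less:
  assumes "j < j'" "j' < t"
  shows "row_sum 0 j < row_sum 0 j'"
proof -
  have m1: "1 < m" using m by auto
  let ?K = "{..<t} - {j, j'}"
  have "(\<Sum>k\<in>{..<t} - {j}. edge_label m t 1 j k) = edge_label m t 1 j j' + (\<Sum>k\<in>?K. edge_label m t 1 j k)"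
    using assms by (subst sum.remove[of _ j']) (auto intro!: arg_cong2[where f = "(+)"] sum.cong)
  also have "\<dots> \<le> edge_label m t 1 j' j + (\<Sum>k\<in>?K. edge_label m t 1 j' k)"
    using assms by (intro add_mono sum_mono less_imp_le[OF edge_label_less_copy_1])
      (auto simp: edge_label_def max.commute min.commute)
  also have "\<dots> = (\<Sum>k\<in>{..<t} - {j'}. edge_label m t 1 j' k)"
    using assms by (subst sum.remove[of "{..<t} - {j'}" j]) (auto intro!: arg_cong2[where f = "(+)"] sum.cong)
  finally have "row_sum 1 j < row_sum 1 j'"
    using assms code_label_less_same_row[of j j' t] code_label_less_same_row[of j j' "t + 1"]
      code_label_less_same_row[of j j' "t + 2"]
    by (simp add: row_sum_split)
  then show ?thesis
    using assms row_sum_balanced[OF m1] by simp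
qed

text \<open>The edges from the first hub to copy \<open>1\<close> already dominate the labels inside copy \<open>1\<close>, and the two
  triangle edges at that hub dominate the edges from \<open>j\<close> to the other two hubs.\<close>

lemma row_sum_less_hub_sum:
  assumes "j < t"
  shows "row_sum 0 j < hub_sum t"
proof -
  have m1: "1 < m" using m by auto
  let ?N = "m * staircase t (t + 3)"
  \<comment> \<open>The row of the first hub comes after all inner positions.\<close>
  have *: "edge_label m t 1 j k \<le> code_label m t 1 t k" if "k < t" "k \<noteq> j" for k
    using that assms m1 code_label_less_later_row[of 1 1 "max j k" t "min j k" k]
    by (auto simp: edge_label_def less_imp_le)
  have "code_label m t 1 (t + 1) j \<le> ?N - m * t"
  proof -
    have "code_label m t 1 (t + 1) j \<le> m * staircase t (Suc (t + 1))"
      using assms m1 by (intro block_bounds) auto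
    also have "\<dots> = ?N - m * t"
      by (simp add: staircase_def eval_nat_numeral algebra_simps)
    finally show ?thesis .
  qed
  moreover have "code_label m t 1 (t + 2) j \<le> ?N + 1"
    using assms m1 by (intro code_label_le_top) auto
  ultimately have hubs: "code_label m t 1 (t + 1) j + code_label m t 1 (t + 2) j <
      code_label m t 0 (t + 1) t + code_label m t 0 (t + 2) t"
    by (auto simp: code_label_def)
  have "row_sum 1 j = (\<Sum>k\<in>{..<t} - {j}. edge_label m t 1 j k) + code_label m t 1 t j +
      (code_label m t 1 (t + 1) j + code_label m t 1 (t + 2) j)"
    using assms by (simp add: row_sum_split)
  also have "\<dots> < (\<Sum>k\<in>{..<t} - {j}. code_label m t 1 t k) + code_label m t 1 t j +
      (code_label m t 0 (t + 1) t + code_label m t 0 (t + 2) t)"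
    using * by (intro add_le_less_mono[OF _ hubs] add_mono sum_mono) auto
  also have "(\<Sum>k\<in>{..<t} - {j}. code_label m t 1 t k) + code_label m t 1 t j = (\<Sum>k<t. edge_label m t 1 t k)"
    using assms by (subst sum.remove[of "{..<t}" j]) (auto simp: edge_label_def max_def min_def intro!: sum.cong)
  also have "\<dots> \<le> (\<Sum>i<m. \<Sum>k<t. edge_label m t i t k)"
    using m1 by (intro member_le_sum[of 1 _ "\<lambda>i. \<Sum>k<t. edge_label m t i t k"]) auto
  also have "code_label m t 0 (t + 1) t + code_label m t 0 (t + 2) t = (\<Sum>k\<in>{t..<t + 3} - {t}. edge_label m t 0 t k)"
  proof -
    have "{t..<t + 3} - {t} = {t + 1, t + 2}" by auto
    then show ?thesis by (simp add: edge_label_def)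
  qed
  finally show ?thesis
    using row_sum_balanced[OF m1] assms by (simp add: hub_sum_def)
qed

lemma hub_sum_less:
  shows "hub_sum t < hub_sum (t + 1)" "hub_sum (t + 1) < hub_sum (t + 2)"
proof -
  have less: "(\<Sum>i<m. \<Sum>k<t. edge_label m t i j k) \<le> (\<Sum>i<m. \<Sum>k<t. edge_label m t i j' k)"
    if "t \<le> j" "j < j'" "j' < t + 3" for j j'
    using that code_label_less_later_row[of _ _ j j']
    by (intro sum_mono) (auto simp: edge_label_def max_def min_def intro: less_imp_le)
  have tri: "{t..<t + 3} - {t} = {t + 1, t + 2}" "{t..<t + 3} - {t + 1} = {t, t + 2}"
      "{t..<t + 3} - {t + 2} = {t, t + 1}"
    by auto
  show "hub_sum t < hub_sum (t + 1)" 
    using less[of t "t + 1"] unfolding hub_sum_def tri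
    by (intro add_le_less_mono) (simp_all add: edge_label_def code_label_def)
  show "hub_sum (t + 1) < hub_sum (t + 2)"
    using less[of "t + 1" "t + 2"] unfolding hub_sum_def tri
    by (intro add_le_less_mono) (simp_all add: edge_label_def code_label_def)
qed

end

section \<open>Coordinates on the cone over the amalgam\<close>

text \<open>Vertex \<open>j < t + 3\<close> of copy \<open>i\<close> of \<open>K\<^bsub>t+3\<^esub>\<close> in the cone over \<open>A(mK\<^sub>n, K\<^sub>2)\<close>, \<open>n = t + 2\<close>. The hubs come
  last, as in the enumeration of the positions: first the apex, then the two amalgamated vertices.\<close>

definition vertex :: "nat \<Rightarrow> nat \<Rightarrow> nat \<Rightarrow> (nat \<times> nat) + nat" where
  "vertex t i j = (if j < t then Inl (i, j + 2) else if j = t then Inr 0 else Inl (0, j - (t + 1)))"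

lemma vertex_eq_iff:
  assumes "j < t + 3" "j' < t + 3"
  shows "vertex t i j = vertex t i' j' \<longleftrightarrow> j = j' \<and> (j < t \<longrightarrow> i = i')"
  using assms by (auto simp: vertex_def)

lemma edges_amalg_K2:
  "edges (amalg_K2 m n) = {{glue_K2 (i, u), glue_K2 (i, v)} | i u v. i < m \<and> u < n \<and> v < n \<and> u \<noteq> v}"
proof -
  have "edges (amalg_K2 m n) = (\<Union>i\<in>{..<m}. (\<lambda>e. glue_K2 ` Pair i ` e) ` edges (complete_graph n))"
    by (auto simp: amalg_K2_def identify_def copies_def simp del: image_insert)
  also have "edges (complete_graph n) = (\<lambda>(u, v). {u, v}) ` {(u, v). u < n \<and> v < n \<and> u \<noteq> v}"
    by (auto simp: complete_graph_def)
  finally show ?thesis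
    by (auto simp: image_image)
qed

lemma verts_amalg_K2: "verts (amalg_K2 m n) = glue_K2 ` ({..<m} \<times> {..<n})"
  by (simp add: amalg_K2_def identify_def copies_def complete_graph_def)

text \<open>The inverse change of coordinates: \<open>slot t u\<close> is the place in the order of \<open>vertex\<close> of the vertex \<open>u\<close>
  of \<open>K\<^sub>n\<close>.\<close>

definition slot :: "nat \<Rightarrow> nat \<Rightarrow> nat" where
  "slot t u = (if u < 2 then t + 1 + u else u - 2)"

lemma vertex_slot: "u < t + 2 \<Longrightarrow> vertex t i (slot t u) = Inl (glue_K2 (i, u))"
  by (auto simp: vertex_def slot_def glue_K2_def)

lemma bij_betw_slot: "bij_betw (slot t) {..<t + 2} ({..<t + 3} - {t})"
proof -
  have "j \<in> slot t ` {..<t + 2}" if "j < t + 3" "j \<noteq> t" for j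
    using that by (intro image_eqI[of _ _ "if j < t then j + 2 else j - (t + 1)"]) (auto simp: slot_def)
  moreover have "inj_on (slot t) {..<t + 2}"
    by (auto simp: inj_on_def slot_def split: if_splits)
  ultimately show ?thesis
    by (auto simp: bij_betw_def slot_def)
qed

lemma slot_cases:
  assumes "j < t + 3"
  obtains "j = t" | u where "u < t + 2" "j = slot t u"
  using assms bij_betw_imp_surj_on[OF bij_betw_slot[of t]] by blast

lemma slot_less: "u < t + 2 \<Longrightarrow> slot t u < t + 3" "u < t + 2 \<Longrightarrow> slot t u \<noteq> t"
  by (auto simp: slot_def)

lemma slot_eq_iff: "u < t + 2 \<Longrightarrow> v < t + 2 \<Longrightarrow> slot t u = slot t v \<longleftrightarrow> u = v"
  using bij_betw_slot[of t] by (auto simp: bij_betw_def inj_on_def)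

lemma vertex_apex: "vertex t i t = Inr 0"
  by (simp add: vertex_def)

lemma verts_cone_amalg_K2:
  assumes "m \<ge> 1"
  shows "verts (cone (amalg_K2 m (t + 2))) = (\<lambda>(i, j). vertex t i j) ` ({..<m} \<times> {..<t + 3})"
    (is "?V = ?W")
proof
  show "?V \<subseteq> ?W"
  proof
    fix x assume "x \<in> ?V"
    then consider "x = Inr 0" | i u where "i < m" "u < t + 2" "x = Inl (glue_K2 (i, u))"
      unfolding verts_cone verts_amalg_K2 by auto
    then show "x \<in> ?W"
    proof cases
      case 1
      then show ?thesis
        using assms by (intro image_eqI[of _ _ "(0, t)"]) (auto simp: vertex_apex)
    next
      case 2
      then show ?thesis
        using assms by (intro image_eqI[of _ _ "(i, slot t u)"]) (auto simp: vertex_slot slot_less)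
    qed
  qed
  show "?W \<subseteq> ?V"
    unfolding verts_cone verts_amalg_K2 by (auto elim!: slot_cases simp: vertex_apex vertex_slot)
qed

text \<open>The cone over the amalgam over \<open>K\<^sub>2\<close> is the amalgam of the complete graphs \<open>K\<^bsub>n+1\<^esub>\<close> over a triangle.\<close>

lemma edges_cone_amalg_K2:
  "edges (cone (amalg_K2 m (t + 2))) =
    {{vertex t i j, vertex t i k} | i j k. i < m \<and> j < t + 3 \<and> k < t + 3 \<and> j \<noteq> k}"
    (is "?E = ?F")
proof
  show "?E \<subseteq> ?F"
  proof
    fix e assume "e \<in> ?E"
    then consider i u where "i < m" "u < t + 2" "e = {Inl (glue_K2 (i, u)), Inr 0}"
      | i u v where "i < m" "u < t + 2" "v < t + 2" "u \<noteq> v"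
          "e = {Inl (glue_K2 (i, u)), Inl (glue_K2 (i, v))}"
      unfolding edges_cone verts_amalg_K2 edges_amalg_K2 by auto
    then show "e \<in> ?F"
    proof cases
      case 1
      then have "e = {vertex t i (slot t u), vertex t i t}"
        by (simp add: vertex_apex vertex_slot)
      then show ?thesis
        using 1 slot_less[of u t] by fastforce
    next
      case 2
      then have "e = {vertex t i (slot t u), vertex t i (slot t v)}"
        by (simp add: vertex_slot)
      then show ?thesis
        using 2 slot_less slot_eq_iff by blast
    qed
  qed
  have hub: "{Inl (glue_K2 (i, u)), Inr 0} \<in> ?E" if "i < m" "u < t + 2" for i u
    using that unfolding edges_cone verts_amalg_K2 by auto
  have copy: "{Inl (glue_K2 (i, u)), Inl (glue_K2 (i, v))} \<in> ?E"
    if "i < m" "u < t + 2" "v < t + 2" "u \<noteq> v" for i u v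
  proof -
    have "{glue_K2 (i, u), glue_K2 (i, v)} \<in> edges (amalg_K2 m (t + 2))"
      unfolding edges_amalg_K2 using that by blast
    then have "Inl ` {glue_K2 (i, u), glue_K2 (i, v)} \<in> ?E"
      unfolding edges_cone by blast
    then show ?thesis by simp
  qed
  show "?F \<subseteq> ?E"
  proof clarify
    fix i j k assume *: "i < m" "j < t + 3" "k < t + 3" "j \<noteq> k"
    show "{vertex t i j, vertex t i k} \<in> ?E"
      using * hub copy
      by (elim slot_cases[of j] slot_cases[of k])
        (auto simp: vertex_apex vertex_slot insert_commute slot_eq_iff)
  qed
qed

section \<open>The labeling and the two chromatic numbers\<close>

definition code_edge :: "nat \<Rightarrow> nat \<times> nat \<times> nat \<Rightarrow> ((nat \<times> nat) + nat) set" where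
  "code_edge t = (\<lambda>(i, j, k). {vertex t i j, vertex t i k})"

lemma bij_betw_code_edge:
  "bij_betw (code_edge t) (codes m t) (edges (cone (amalg_K2 m (t + 2))))"
proof -
  have "inj_on (code_edge t) (codes m t)"
    by (auto simp: inj_on_def code_edge_def codes_def doubleton_eq_iff vertex_eq_iff)
  moreover have "code_edge t ` codes m t = edges (cone (amalg_K2 m (t + 2)))"
  proof
    show "code_edge t ` codes m t \<subseteq> edges (cone (amalg_K2 m (t + 2)))"
      unfolding edges_cone_amalg_K2 code_edge_def codes_def by fastforce
    have sorted: "{vertex t i j, vertex t i k} \<in> code_edge t ` codes m t"
      if "i < m" "k < j" "j < t + 3" for i j k
      using that
      by (intro image_eqI[of _ _ "(if t \<le> k then 0 else i, j, k)"])
        (auto simp: code_edge_def codes_def vertex_def)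
    show "edges (cone (amalg_K2 m (t + 2))) \<subseteq> code_edge t ` codes m t"
      unfolding edges_cone_amalg_K2
    proof clarify
      fix i j k assume "i < m" "j < t + 3" "k < t + 3" "j \<noteq> k"
      then show "{vertex t i j, vertex t i k} \<in> code_edge t ` codes m t"
        using sorted[of i j k] sorted[of i k j]
        by (cases j k rule: linorder_cases) (auto simp: insert_commute)
    qed
  qed
  ultimately show ?thesis
    by (simp add: bij_betw_def)
qed

context odd_amalgam
begin

definition labeling :: "((nat \<times> nat) + nat) set \<Rightarrow> nat" where
  "labeling = (\<lambda>(i, j, k). code_label m t i j k) \<circ> the_inv_into (codes m t) (code_edge t)"

definition J :: "((nat \<times> nat) + nat) ugraph" where
  "J = cone (amalg_K2 m (t + 2))"

lemma verts_J: "verts J = (\<lambda>(i, j). vertex t i j) ` ({..<m} \<times> {..<t + 3})"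
  unfolding J_def using m by (intro verts_cone_amalg_K2) auto

lemma edges_J:
  "edges J = {{vertex t i j, vertex t i k} | i j k. i < m \<and> j < t + 3 \<and> k < t + 3 \<and> j \<noteq> k}"
  unfolding J_def by (rule edges_cone_amalg_K2)

lemma simple_graph_J: "simple_graph J"
  unfolding J_def cone_def
  by (intro simple_graph_join simple_graph_amalg_K2 simple_graph_complete_graph)

lemma bij_betw_labeling: "bij_betw labeling (edges J) {1..card (edges J)}"
proof -
  have "bij_betw labeling (edges J) {1..m * staircase t (t + 3) + 3}"
    unfolding labeling_def J_def
    by (intro bij_betw_trans[OF bij_betw_the_inv_into[OF bij_betw_code_edge]] bij_betw_code_label)
  then show ?thesis
    using bij_betw_same_card[of labeling] by (metis card_atLeastAtMost diff_Suc_1)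
qed

lemma labeling_edge:
  assumes "i < m" "j < t + 3" "k < t + 3" "j \<noteq> k"
  shows "labeling {vertex t i j, vertex t i k} = edge_label m t i j k"
proof -
  have sorted: "labeling {vertex t i j, vertex t i k} = code_label m t i j k"
    if "k < j" "j < t + 3" for j k
  proof -
    let ?c = "(if t \<le> k then 0 else i, j, k)"
    have c: "?c \<in> codes m t"
      using that assms(1) by (auto simp: codes_def)
    have "{vertex t i j, vertex t i k} = code_edge t ?c"
      using that by (auto simp: code_edge_def vertex_def)
    then have "labeling {vertex t i j, vertex t i k} = (\<lambda>(i, j, k). code_label m t i j k) ?c"
      using c bij_betw_imp_inj_on[OF bij_betw_code_edge]
      by (simp only: labeling_def o_apply the_inv_into_f_f)
    then show ?thesis
      by (auto simp: code_label_def)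
  qed
  show ?thesis
    using assms sorted[of k j] sorted[of j k]
    by (cases j k rule: linorder_cases) (auto simp: edge_label_def max_def min_def insert_commute)
qed

definition colour :: "nat \<Rightarrow> nat" where
  "colour j = (if j < t then row_sum 0 j else hub_sum j)"

lemma adjacent_iff:
  assumes "i < m" "j < t + 3"
  shows "{vertex t i j, v} \<in> edges J \<longleftrightarrow>
    (\<exists>i' k. v = vertex t i' k \<and> i' < m \<and> k < t + 3 \<and> k \<noteq> j \<and> (j < t \<longrightarrow> i' = i))"
proof
  assume "{vertex t i j, v} \<in> edges J"
  then obtain i' j' k where "i' < m" "j' < t + 3" "k < t + 3" "j' \<noteq> k"
      "vertex t i j = vertex t i' j'" "v = vertex t i' k"
    unfolding edges_J by (auto simp: doubleton_eq_iff)
  then show "\<exists>i' k. v = vertex t i' k \<and> i' < m \<and> k < t + 3 \<and> k \<noteq> j \<and> (j < t \<longrightarrow> i' = i)"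
    using assms(2) vertex_eq_iff[of j t j' i i'] by auto
next
  assume "\<exists>i' k. v = vertex t i' k \<and> i' < m \<and> k < t + 3 \<and> k \<noteq> j \<and> (j < t \<longrightarrow> i' = i)"
  then obtain i' k where *: "v = vertex t i' k" "i' < m" "k < t + 3" "k \<noteq> j" "j < t \<longrightarrow> i' = i"
    by blast
  then have "vertex t i j = vertex t i' j"
    using assms by (simp add: vertex_eq_iff)
  then have "{vertex t i j, v} = {vertex t i' j, vertex t i' k}"
    using * by simp
  moreover have "{vertex t i' j, vertex t i' k} \<in> edges J"
    unfolding edges_J using *(2-4) assms(2) by blast
  ultimately show "{vertex t i j, v} \<in> edges J"
    by (simp only:)
qed

lemma edge_weight_labeling:
  assumes "i < m" "j < t + 3"
  shows "edge_weight J labeling (vertex t i j) = colour j"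
proof (cases "j < t")
  case True
  have "{v. {vertex t i j, v} \<in> edges J} = vertex t i ` ({..<t + 3} - {j})"
    using True assms by (auto simp: adjacent_iff)
  moreover have "inj_on (vertex t i) ({..<t + 3} - {j})"
    by (auto simp: inj_on_def vertex_eq_iff)
  ultimately have "edge_weight J labeling (vertex t i j) =
      (\<Sum>k\<in>{..<t + 3} - {j}. labeling {vertex t i j, vertex t i k})"
    by (simp add: edge_weight_neighbours[OF simple_graph_J] sum.reindex)
  also have "\<dots> = row_sum i j"
    unfolding row_sum_def using assms by (intro sum.cong) (auto simp: labeling_edge)
  finally show ?thesis
    using True row_sum_balanced[OF assms(1) True] by (simp add: colour_def)
next
  case False
  have m0: "0 < m" using m by auto
  have vj: "vertex t i j = vertex t i' j" for i'
    using False by (simp add: vertex_def)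
  let ?A = "(\<lambda>(i, k). vertex t i k) ` ({..<m} \<times> {..<t})" and ?B = "vertex t 0 ` ({t..<t + 3} - {j})"
  have "{v. {vertex t i j, v} \<in> edges J} = ?A \<union> ?B"
  proof (intro equalityI subsetI)
    fix v assume "v \<in> {v. {vertex t i j, v} \<in> edges J}"
    then obtain i' k where *: "v = vertex t i' k" "i' < m" "k < t + 3" "k \<noteq> j"
      using False assms by (auto simp: adjacent_iff)
    show "v \<in> ?A \<union> ?B"
    proof (cases "k < t")
      case True
      then show ?thesis using * by auto
    next
      case False
      then have "v = vertex t 0 k"
        using * by (simp add: vertex_def)
      then show ?thesis using * False by auto
    qed
  next
    fix v assume "v \<in> ?A \<union> ?B"
    then show "v \<in> {v. {vertex t i j, v} \<in> edges J}"
      using False assms m0 by (fastforce simp: adjacent_iff)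
  qed
  moreover have "?A \<inter> ?B = {}"
    by (auto simp: vertex_eq_iff)
  moreover have "inj_on (\<lambda>(i, k). vertex t i k) ({..<m} \<times> {..<t})"
      "inj_on (vertex t 0) ({t..<t + 3} - {j})"
    by (auto simp: inj_on_def vertex_eq_iff)
  ultimately have "edge_weight J labeling (vertex t i j) =
      (\<Sum>(i', k)\<in>{..<m} \<times> {..<t}. labeling {vertex t i j, vertex t i' k}) +
      (\<Sum>k\<in>{t..<t + 3} - {j}. labeling {vertex t i j, vertex t 0 k})"
    by (simp add: edge_weight_neighbours[OF simple_graph_J] sum.union_disjoint sum.reindex
        case_prod_unfold)
  also have "(\<Sum>(i', k)\<in>{..<m} \<times> {..<t}. labeling {vertex t i j, vertex t i' k}) =
      (\<Sum>(i', k)\<in>{..<m} \<times> {..<t}. edge_label m t i' j k)"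
  proof (intro sum.cong refl, clarsimp)
    fix i' k assume "i' < m" "k < t"
    then show "labeling {vertex t i j, vertex t i' k} = edge_label m t i' j k"
      using labeling_edge[of i' j k] vj[of i'] False assms by simp
  qed
  also have "\<dots> = (\<Sum>i'<m. \<Sum>k<t. edge_label m t i' j k)"
    by (simp add: sum.cartesian_product)
  also have "(\<Sum>k\<in>{t..<t + 3} - {j}. labeling {vertex t i j, vertex t 0 k}) =
      (\<Sum>k\<in>{t..<t + 3} - {j}. edge_label m t 0 j k)"
    using labeling_edge[of 0 j] vj[of 0] assms m0 by (intro sum.cong) auto
  finally show ?thesis
    using False by (simp add: colour_def hub_sum_def)
qed

lemma colour_less:
  assumes "j < j'" "j' < t + 3"
  shows "colour j < colour j'"
proof -
  have hubs: "hub_sum t \<le> hub_sum j'" if "\<not> j' < t"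
  proof -
    have "j' = t \<or> j' = t + 1 \<or> j' = t + 2"
      using that assms by linarith
    then show ?thesis
      using hub_sum_less by auto
  qed
  consider "j' < t" | "j < t" "\<not> j' < t" | "j = t" "j' = t + 1" | "j = t" "j' = t + 2"
      | "j = t + 1" "j' = t + 2"
    using assms by linarith
  then show ?thesis
  proof cases
    case 1
    then show ?thesis using assms row_sum_less by (simp add: colour_def)
  next
    case 2
    then show ?thesis
      using hubs row_sum_less_hub_sum[of j] by (simp add: colour_def)
  qed (use hub_sum_less in \<open>simp_all add: colour_def\<close>)
qed

lemma colour_inject:
  assumes "j < t + 3" "j' < t + 3" "colour j = colour j'"
  shows "j = j'"
  using assms colour_less[of j j'] colour_less[of j' j] by (cases j j' rule: linorder_cases) auto

lemma local_antimagic_labeling: "local_antimagic J labeling"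
  unfolding local_antimagic_def
proof (intro conjI allI impI bij_betw_labeling)
  fix u v assume "{u, v} \<in> edges J"
  then obtain i j k where "i < m" "j < t + 3" "k < t + 3" "j \<noteq> k" 
      "u = vertex t i j" "v = vertex t i k"
    unfolding edges_J by (auto simp: doubleton_eq_iff)
  then show "edge_weight J labeling u \<noteq> edge_weight J labeling v"
    using colour_inject by (auto simp: edge_weight_labeling)
qed

lemma finite_verts: "finite (verts (amalg_K2 m n))"
  using simple_graph_amalg_K2 by (auto simp: simple_graph_def)

lemma chi_la_J: "chi_la J = t + 3"
proof -
  have m1: "1 \<le> m" "0 < m" using m by auto
  let ?K = "vertex t 0 ` {..<t + 3}"
  have K: "card ?K = t + 3"
    by (subst card_image) (auto simp: inj_on_def vertex_eq_iff)
  have "edge_weight J labeling ` verts J \<subseteq> colour ` {..<t + 3}"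
    using m1 by (auto simp: verts_J edge_weight_labeling)
  then have "card (edge_weight J labeling ` verts J) \<le> card {..<t + 3}"
    by (rule surj_card_le[OF finite_lessThan])
  moreover have "?K \<subseteq> verts J"
    using m1 by (auto simp: verts_J)
  moreover have "{u, v} \<in> edges J" if "u \<in> ?K" "v \<in> ?K" "u \<noteq> v" for u v
    using that m1 unfolding edges_J by blast
  ultimately show ?thesis
    using chi_la_eqI[OF local_antimagic_labeling, of ?K] simple_graph_J
    unfolding K by (auto simp: simple_graph_def)
qed

text \<open>The weights on the base of the cone avoid the colour of the apex, which is \<open>colour t\<close>.\<close>

lemma chi_lat_amalg_K2: "chi_lat (amalg_K2 m (t + 2)) = t + 2"
proof -
  have m0: "0 < m" using m by auto
  let ?G = "amalg_K2 m (t + 2)"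
  let ?f = "labeling \<circ> cone_edge" and ?K = "(\<lambda>u. glue_K2 (0, u)) ` {..<t + 2}"
  have f: "local_antimagic_total ?G ?f"
    using local_antimagic_labeling unfolding J_def
    by (intro local_antimagic_total_cone simple_graph_amalg_K2)
  have K: "card ?K = t + 2"
    by (subst card_image) (auto simp: inj_on_def glue_K2_def split: if_splits)
  have "total_weight ?G ?f ` verts ?G \<subseteq> colour ` slot t ` {..<t + 2}"
  proof clarify
    fix x assume x: "x \<in> verts ?G"
    then obtain i u where iu: "i < m" "u < t + 2" "x = glue_K2 (i, u)"
      by (auto simp: verts_amalg_K2)
    have "finite (edges ?G)"
      by (intro finite_edges simple_graph_amalg_K2)
    then have "total_weight ?G ?f x = edge_weight J labeling (vertex t i (slot t u))"
      using x iu by (simp add: total_weight_cone vertex_slot J_def)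
    also have "\<dots> = colour (slot t u)"
      using iu by (intro edge_weight_labeling slot_less)
    finally show "total_weight ?G ?f x \<in> colour ` slot t ` {..<t + 2}"
      using iu by simp
  qed
  then have "card (total_weight ?G ?f ` verts ?G) \<le> card {..<t + 2}"
    unfolding image_comp by (rule surj_card_le[OF finite_lessThan])
  then have few: "card (total_weight ?G ?f ` verts ?G) \<le> card ?K"
    by (simp only: K card_lessThan)
  have sub: "?K \<subseteq> verts ?G"
    using m0 by (auto simp: verts_amalg_K2)
  have clique: "{u, v} \<in> edges ?G" if "u \<in> ?K" "v \<in> ?K" "u \<noteq> v" for u v
    using that m0 unfolding edges_amalg_K2 by blast
  have "chi_lat ?G = card ?K"
    by (rule chi_lat_eqI[OF f few finite_verts sub clique])
  then show ?thesis
    by (simp only: K)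
qed

end

theorem theorem2p13:
  fixes m n :: nat
  assumes "2 \<le> m" and "m \<le> 3"
    and "n \<ge> 3" and "odd n"
  shows "chi_lat (amalg_K2 m n) = n \<and>
         chi_la (join (amalg_K2 m n) (complete_graph 1)) = n + 1"
proof -
  interpret odd_amalgam m "n - 2"
    using assms by unfold_locales auto
  have "n - 2 + 2 = n" "n - 2 + 3 = n + 1"
    using assms(3) by auto
  then show ?thesis
    using chi_lat_amalg_K2 chi_la_J by (simp only: J_def cone_def)
qed

end
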